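(* There is a planar graph $G$ with $$3=\chi_{ad}(G)=\mathrm{ch}_{sep}(G)<\mathrm{ch}_{ad}(G)=\chi_{\nleftrightarrow}(G)=4.$$
   Context: Graphs are finite and simple. Given an edge coloring $f$ of $G$ (an arbitrary map from edges to colors, not necessarily proper), a vertex coloring $c$ (not necessarily proper) is adapted to $f$ if no edge $xy$ satisfies $c(x)=c(y)=f(xy)$. $\chi_{ad}(G)$ (adaptable chromatic number) is the smallest $k$ such that for every edge coloring $f$ of $G$ with colors $\{1,\dots,k\}$ there is a vertex coloring $c:V(G)\to\{1,\dots,k\}$ adapted to $f$. $\mathrm{ch}_{ad}(G)$ (adaptable choosability) is the smallest $k$ such that for every edge coloring $f$ and every assignment of lists $L(v)$ of $k$ colors to the vertices, there is a coloring $c$ adapted to $f$ with $c(v)\in L(v)$ for all $v$. $\mathrm{ch}_{sep}(G)$ (separation choosability) is the smallest $k$ such that for every assignment of lists $L(v)$ of $k$ colors to the vertices with $|L(x)\cap L(y)|\le 1$ for every edge $xy$, there is a proper coloring $\varphi$ of $G$ with $\varphi(v)\in L(v)$ for all $v$. A local $k$-partition of $G$ is a collection $\{c_v\}_{v\in V(G)}$ of maps $c_v : E(v)\to\{1,\dots,k\}$, where $E(v)$ is the set of edges incident with $v$. $G$ is conflict $\{c_v\}$-colorable if there is a map $\varphi : V(G)\to\{1,\dots,k\}$ such that no edge $e=xy$ satisfies both $\varphi(x)=c_x(e)$ and $\varphi(y)=c_y(e)$. $\chi_{\nleftrightarrow}(G)$ (single conflict chromatic number) is the smallest $k$ such that $G$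 is conflict $\{c_v\}$-colorable for every local $k$-partition. *)

theory Defs
  imports "HOL-Analysis.Analysis"
begin

definition simple_graph :: "'a set \<Rightarrow> 'a set set \<Rightarrow> bool" where
  "simple_graph V E \<longleftrightarrow> finite V \<and> (\<forall>e\<in>E. e \<subseteq> V \<and> card e = 2)"

definition incident_edges :: "'a set set \<Rightarrow> 'a \<Rightarrow> 'a set set" where
  "incident_edges E v = {e \<in> E. v \<in> e}"

text \<open>
  A graph is planar if it has a drawing in the plane without crossings: vertices are distinct
  points, every edge is a simple arc joining its two end points and passing through no other vertex,
  and two different edges meet only in a common end point.
\<close>

definition plane_drawing ::
    "'a set \<Rightarrow> 'a set set \<Rightarrow> ('a \<Rightarrow> complex) \<Rightarrow> ('a set \<Rightarrow> real \<Rightarrow> complex) \<Rightarrow> bool" where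
  "plane_drawing V E p g \<longleftrightarrow>
     inj_on p V \<and>
     (\<forall>e\<in>E. arc (g e) \<and> {pathstart (g e), pathfinish (g e)} = p ` e \<and>
        path_image (g e) \<inter> p ` V = p ` e) \<and>
     (\<forall>e\<in>E. \<forall>e'\<in>E. e \<noteq> e' \<longrightarrow> path_image (g e) \<inter> path_image (g e') = p ` (e \<inter> e'))"

definition planar :: "'a set \<Rightarrow> 'a set set \<Rightarrow> bool" where
  "planar V E \<longleftrightarrow> (\<exists>p g. plane_drawing V E p g)"

definition proper_coloring :: "'a set set \<Rightarrow> ('a \<Rightarrow> nat) \<Rightarrow> bool" where
  "proper_coloring E c \<longleftrightarrow> (\<forall>x y. {x, y} \<in> E \<longrightarrow> c x \<noteq> c y)"

definition adapted :: "'a set set \<Rightarrow> ('a set \<Rightarrow> nat) \<Rightarrow> ('a \<Rightarrow> nat) \<Rightarrow> bool" where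
  "adapted E f c \<longleftrightarrow> (\<forall>x y. {x, y} \<in> E \<longrightarrow> \<not> (c x = c y \<and> c y = f {x, y}))"

definition list_assignment :: "'a set \<Rightarrow> nat \<Rightarrow> ('a \<Rightarrow> nat set) \<Rightarrow> bool" where
  "list_assignment V k L \<longleftrightarrow> (\<forall>v\<in>V. finite (L v) \<and> card (L v) = k)"

definition local_partition :: "'a set \<Rightarrow> 'a set set \<Rightarrow> nat \<Rightarrow> ('a \<Rightarrow> 'a set \<Rightarrow> nat) \<Rightarrow> bool" where
  "local_partition V E k cv \<longleftrightarrow> (\<forall>v\<in>V. \<forall>e\<in>incident_edges E v. cv v e \<in> {1..k})"

definition conflict_colorable ::
    "'a set \<Rightarrow> 'a set set \<Rightarrow> nat \<Rightarrow> ('a \<Rightarrow> 'a set \<Rightarrow> nat) \<Rightarrow> bool" where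
  "conflict_colorable V E k cv \<longleftrightarrow>
     (\<exists>\<phi>. (\<forall>v\<in>V. \<phi> v \<in> {1..k}) \<and>
        (\<forall>x y. {x, y} \<in> E \<longrightarrow> \<not> (\<phi> x = cv x {x, y} \<and> \<phi> y = cv y {x, y})))"

text \<open>
  The four parameters are minima over positive \<open>k\<close>. Positivity matters: a graph with an edge has
  no edge coloring from \<open>{1..0}\<close> and no local \<open>0\<close>-partition, so \<open>k = 0\<close> would qualify vacuously.
  For a finite simple graph every one of these minima exists, as \<open>k = max 1 (card V)\<close> qualifies.
\<close>

definition adaptable_chromatic_number :: "'a set \<Rightarrow> 'a set set \<Rightarrow> nat" where
  "adaptable_chromatic_number V E =
     (LEAST k. 1 \<le> k \<and>
        (\<forall>f. (\<forall>e\<in>E. f e \<in> {1..k}) \<longrightarrow> (\<exists>c. (\<forall>v\<in>V. c v \<in> {1..k}) \<and> adapted E f c)))"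

text \<open>
  Natural numbers suffice as colors for lists and for the edge colorings in the next definition:
  on a finite graph only finitely many colors occur.
\<close>

definition adaptable_choosability :: "'a set \<Rightarrow> 'a set set \<Rightarrow> nat" where
  "adaptable_choosability V E =
     (LEAST k. 1 \<le> k \<and>
        (\<forall>f L. list_assignment V k L \<longrightarrow> (\<exists>c. (\<forall>v\<in>V. c v \<in> L v) \<and> adapted E f c)))"

definition separation_choosability :: "'a set \<Rightarrow> 'a set set \<Rightarrow> nat" where
  "separation_choosability V E =
     (LEAST k. 1 \<le> k \<and>
        (\<forall>L. list_assignment V k L \<and> (\<forall>x y. {x, y} \<in> E \<longrightarrow> card (L x \<inter> L y) \<le> 1) \<longrightarrow>
           (\<exists>\<phi>. (\<forall>v\<in>V. \<phi> v \<in> L v) \<and> proper_coloring E \<phi>)))"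

definition single_conflict_chromatic_number :: "'a set \<Rightarrow> 'a set set \<Rightarrow> nat" where
  "single_conflict_chromatic_number V E =
     (LEAST k. 1 \<le> k \<and> (\<forall>cv. local_partition V E k cv \<longrightarrow> conflict_colorable V E k cv))"

end

theory Submission
  imports Defs
begin

text \<open>
  Take two non-adjacent hubs \<open>0\<close>, \<open>1\<close> and nine disjoint edges \<open>{2i+2, 2i+3}\<close>, each of whose ends is
  joined to both hubs. The graph is 3-colorable and 3-degenerate. Give the hubs disjoint 3-lists;
  the \<open>i\<close>-th edge rules out the \<open>i\<close>-th of the nine pairs \<open>(a, b)\<close> of hub colors: both of its ends
  have the list \<open>{a, b, x}\<close>, the hub edges have colors \<open>a\<close> and \<open>b\<close>, and the edge itself has color
  \<open>x\<close>. This cannot be imitated with separated lists, since the two ends have at most one color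
  in common, so that every coloring of the hubs extends.
\<close>

section \<open>The hub graph and its edges\<close>

definition hub_verts :: "nat \<Rightarrow> nat set" where
  "hub_verts n = {..<2 * n + 2}"

text \<open>The number \<open>n\<close> of pairs stays free: planarity and the upper bounds hold for
  every \<open>n\<close>, while the lower bounds need 1, 2, 4 and 9 pairs.\<close>

definition hub_edges :: "nat \<Rightarrow> nat set set" where
  "hub_edges n = {{0, w} |w. w \<in> {2..<2 * n + 2}} \<union> {{1, w} |w. w \<in> {2..<2 * n + 2}} \<union>
     {{2 * i + 2, 2 * i + 3} |i. i < n}"

lemma hub_edges_cases:
  assumes "e \<in> hub_edges n"
  obtains (zero) w where "e = {0, w}" "2 \<le> w" "w < 2 * n + 2"
    | (one) w where "e = {1, w}" "2 \<le> w" "w < 2 * n + 2"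
    | (pair) i where "e = {2 * i + 2, 2 * i + 3}" "i < n"
  using assms unfolding hub_edges_def by fastforce

lemma hub_edges_intros:
  "2 \<le> w \<Longrightarrow> w < 2 * n + 2 \<Longrightarrow> {0, w} \<in> hub_edges n"
  "2 \<le> w \<Longrightarrow> w < 2 * n + 2 \<Longrightarrow> {1, w} \<in> hub_edges n"
  "i < n \<Longrightarrow> {2 * i + 2, 2 * i + 3} \<in> hub_edges n"
  unfolding hub_edges_def by auto

text \<open>Edges are sets, but the coloring conditions range over ordered pairs \<open>x\<close>,
  \<open>y\<close>; for a symmetric \<open>P\<close> one orientation of each kind of edge is
  enough.\<close>

lemma hub_edge_ends:
  assumes "{x, y} \<in> hub_edges n"
    and "\<And>x y. P x y \<Longrightarrow> P y x"
    and "\<And>w. 2 \<le> w \<Longrightarrow> w < 2 * n + 2 \<Longrightarrow> P 0 w"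
    and "\<And>w. 2 \<le> w \<Longrightarrow> w < 2 * n + 2 \<Longrightarrow> P 1 w"
    and "\<And>i. i < n \<Longrightarrow> P (2 * i + 2) (2 * i + 3)"
  shows "P x y"
  using assms(1)
proof (cases rule: hub_edges_cases)
  case (zero w) then show ?thesis using assms(2,3) by (auto simp: doubleton_eq_iff)
next
  case (one w) then show ?thesis using assms(2,4) by (auto simp: doubleton_eq_iff)
next
  case (pair i) then show ?thesis using assms(2) assms(5)[of i] by (auto simp: doubleton_eq_iff)
qed

lemma simple_graph_hub: "simple_graph (hub_verts n) (hub_edges n)"
  unfolding simple_graph_def hub_verts_def
  by (auto elim!: hub_edges_cases)

subsection \<open>Planarity\<close>

text \<open>This gives a straight-line drawing: edges at hub \<open>0\<close> stay in the closed
  upper half-plane, edges at hub \<open>1\<close> in the closed lower one, and pair edges on the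
  real axis.\<close>

definition hub_pos :: "nat \<Rightarrow> complex" where
  "hub_pos v = (if v = 0 then \<i> else if v = 1 then - \<i> else of_nat v)"

lemma hub_pos_simps:
  "hub_pos 0 = \<i>" "hub_pos (Suc 0) = - \<i>" "2 \<le> w \<Longrightarrow> hub_pos w = of_nat w"
  by (auto simp: hub_pos_def)

lemma inj_hub_pos: "inj hub_pos"
  by (auto simp: inj_def hub_pos_def complex_eq_iff)

lemma segment_zero:
  assumes "2 \<le> w" "z \<in> closed_segment (hub_pos 0) (hub_pos w)"
  shows "0 \<le> Im z" "Im z \<le> 1" "Re z = real w * (1 - Im z)"
  using assms by (auto simp: hub_pos_simps closed_segment_def)

lemma segment_one:
  assumes "2 \<le> w" "z \<in> closed_segment (hub_pos 1) (hub_pos w)"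
  shows "- 1 \<le> Im z" "Im z \<le> 0" "Re z = real w * (1 + Im z)"
  using assms by (auto simp: hub_pos_simps closed_segment_def)

lemma segment_pair:
  assumes "z \<in> closed_segment (hub_pos (2 * i + 2)) (hub_pos (2 * i + 3))"
  shows "Im z = 0" "2 * real i + 2 \<le> Re z" "Re z \<le> 2 * real i + 3"
proof -
  obtain u where u: "0 \<le> u" "u \<le> 1" and
    z: "z = (1 - u) *\<^sub>R of_nat (2 * i + 2) + u *\<^sub>R of_nat (2 * i + 3)"
    using assms by (auto simp: hub_pos_simps closed_segment_def)
  have "Re z = 2 * real i + 2 + u" "Im z = 0"
    unfolding z by (simp_all add: algebra_simps)
  with u show "Im z = 0" "2 * real i + 2 \<le> Re z" "Re z \<le> 2 * real i + 3"
    by simp_all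
qed

text \<open>\<open>Min\<close> and \<open>Max\<close> orient the edge; a hub, being 0 or 1, is
  always the starting point.\<close>

definition hub_path :: "nat set \<Rightarrow> real \<Rightarrow> complex" where
  "hub_path e = linepath (hub_pos (Min e)) (hub_pos (Max e))"

lemma hub_path_image_cases:
  assumes "e \<in> hub_edges n" "z \<in> path_image (hub_path e)"
  obtains (zero) w where "e = {0, w}" "2 \<le> w" "0 \<le> Im z" "Im z \<le> 1"
      "Re z = real w * (1 - Im z)"
    | (one) w where "e = {1, w}" "2 \<le> w" "- 1 \<le> Im z" "Im z \<le> 0"
      "Re z = real w * (1 + Im z)"
    | (pair) i where "e = {2 * i + 2, 2 * i + 3}" "Im z = 0"
      "2 * real i + 2 \<le> Re z" "Re z \<le> 2 * real i + 3"
  using assms(1)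
proof (cases rule: hub_edges_cases)
  case (zero w)
  then have "z \<in> closed_segment (hub_pos 0) (hub_pos w)"
    using assms(2) by (simp add: hub_path_def)
  from segment_zero[OF zero(2) this] show ?thesis by (rule that(1)[OF zero(1,2)])
next
  case (one w)
  then have "z \<in> closed_segment (hub_pos 1) (hub_pos w)"
    using assms(2) by (simp add: hub_path_def)
  from segment_one[OF one(2) this] show ?thesis by (rule that(2)[OF one(1,2)])
next
  case (pair i)
  then have "z \<in> closed_segment (hub_pos (2 * i + 2)) (hub_pos (2 * i + 3))"
    using assms(2) by (simp add: hub_path_def)
  from segment_pair[OF this] show ?thesis by (rule that(3)[OF pair(1)])
qed

lemma hub_path_meets_vertex:
  assumes "e \<in> hub_edges n" "hub_pos v \<in> path_image (hub_path e)"
  shows "v \<in> e"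
  using assms
proof (cases rule: hub_path_image_cases)
  case (zero w) then show ?thesis
    by (auto simp: hub_pos_def split: if_splits)
next
  case (one w) then show ?thesis
    by (auto simp: hub_pos_def split: if_splits)
next
  case (pair i)
  \<comment> \<open>A pair edge has length one, so its ends are the only integers on it;
    \<open>Im z = 0\<close> excludes the hubs.\<close>
  then have "2 * i + 2 \<le> v \<and> v \<le> 2 * i + 3"
    by (auto simp: hub_pos_def split: if_splits)
  with pair(1) show ?thesis by auto
qed

text \<open>Away from the vertices, a point of the drawing determines the edge that it lies on.\<close>

definition edge_at :: "complex \<Rightarrow> nat set" where
  "edge_at z = (if 0 < Im z then {0, nat \<lfloor>Re z / (1 - Im z)\<rfloor>}
     else if Im z < 0 then {1, nat \<lfloor>Re z / (1 + Im z)\<rfloor>}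
     else {nat \<lfloor>Re z\<rfloor>, nat \<lfloor>Re z\<rfloor> + 1})"

text \<open>Projection from hub \<open>0\<close> to the real axis takes a point \<open>z\<close> of
  an edge at that hub to \<open>Re z / (1 - Im z)\<close>, the far end of the edge; hub
  \<open>1\<close> is symmetric. Excluding vertices keeps \<open>Im z\<close> and the denominators
  nonzero.\<close>

lemma edge_at_eq:
  assumes "e \<in> hub_edges n" "z \<in> path_image (hub_path e)" "z \<notin> range hub_pos"
  shows "edge_at z = e"
  using assms(1,2)
proof (cases rule: hub_path_image_cases)
  case (zero w)
  have "z \<noteq> hub_pos 0" "z \<noteq> hub_pos w" using assms(3) by auto
  then have "Im z \<noteq> 1" "Im z \<noteq> 0"
    using zero by (auto simp: hub_pos_simps complex_eq_iff)
  with zero show ?thesis by (simp add: edge_at_def)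
next
  case (one w)
  have "z \<noteq> hub_pos 1" "z \<noteq> hub_pos w" using assms(3) by auto
  then have "Im z \<noteq> - 1" "Im z \<noteq> 0"
    using one by (auto simp: hub_pos_simps complex_eq_iff)
  with one show ?thesis by (simp add: edge_at_def)
next
  case (pair i)
  \<comment> \<open>Rounding down fails only at the right end, where it gives
    \<open>2 * i + 3\<close>.\<close>
  have "z \<noteq> hub_pos (2 * i + 3)" using assms(3) by auto
  then have "Re z \<noteq> 2 * real i + 3"
    using pair by (auto simp: hub_pos_simps complex_eq_iff)
  then have "\<lfloor>Re z\<rfloor> = 2 * int i + 2"
    using pair by (simp add: floor_eq_iff)
  then have "nat \<lfloor>Re z\<rfloor> = 2 * i + 2" by simp
  with pair show ?thesis by (simp add: edge_at_def eval_nat_numeral)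
qed

lemma planar_hub: "planar (hub_verts n) (hub_edges n)"
proof -
  have ends: "{pathstart (hub_path e), pathfinish (hub_path e)} = hub_pos ` e"
    if "e \<in> hub_edges n" for e
    using that by (cases rule: hub_edges_cases) (auto simp: hub_path_def)
  have ends_subset: "hub_pos ` e \<subseteq> path_image (hub_path e)" if "e \<in> hub_edges n" for e
    unfolding ends[OF that, symmetric]
    by (simp add: pathstart_in_path_image pathfinish_in_path_image)
  have "arc (hub_path e)" if "e \<in> hub_edges n" for e
    using that
    by (cases rule: hub_edges_cases)
      (auto simp: hub_path_def intro!: arc_linepath dest: injD[OF inj_hub_pos])
  moreover have "path_image (hub_path e) \<inter> hub_pos ` hub_verts n = hub_pos ` e"
    if e: "e \<in> hub_edges n" for e
  proof -
    have "e \<subseteq> hub_verts n" using e simple_graph_hub[of n] by (simp add: simple_graph_def)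
    then show ?thesis using ends_subset[OF e] hub_path_meets_vertex[OF e] by blast
  qed
  moreover have "path_image (hub_path e) \<inter> path_image (hub_path e') = hub_pos ` (e \<inter> e')"
    if e: "e \<in> hub_edges n" and e': "e' \<in> hub_edges n" and "e \<noteq> e'" for e e'
  proof
    show "hub_pos ` (e \<inter> e') \<subseteq> path_image (hub_path e) \<inter> path_image (hub_path e')"
      using ends_subset[OF e] ends_subset[OF e'] by blast
    show "path_image (hub_path e) \<inter> path_image (hub_path e') \<subseteq> hub_pos ` (e \<inter> e')"
    proof
      fix z assume z: "z \<in> path_image (hub_path e) \<inter> path_image (hub_path e')"
      \<comment> \<open>Otherwise \<open>edge_at z\<close> would equal both \<open>e\<close> and
        \<open>e'\<close>.\<close>
      then have "z \<in> range hub_pos"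
        using edge_at_eq[OF e] edge_at_eq[OF e'] \<open>e \<noteq> e'\<close> by blast
      then show "z \<in> hub_pos ` (e \<inter> e')"
        using z hub_path_meets_vertex[OF e] hub_path_meets_vertex[OF e'] by blast
    qed
  qed
  ultimately have "plane_drawing (hub_verts n) (hub_edges n) hub_pos hub_path"
    using ends inj_on_subset[OF inj_hub_pos subset_UNIV]
    unfolding plane_drawing_def by (intro conjI ballI impI)
  then show ?thesis unfolding planar_def by blast
qed

subsection \<open>Comparison of the parameters\<close>

text \<open>This and the next three predicates name the conditions minimized in the four parameters,
  so that the \<open>LEAST\<close> terms can be folded.\<close>

definition adaptable :: "'a set \<Rightarrow> 'a set set \<Rightarrow> nat \<Rightarrow> bool" where
  "adaptable V E k \<longleftrightarrow>
     (\<forall>f. (\<forall>e\<in>E. f e \<in> {1..k}) \<longrightarrow> (\<exists>c. (\<forall>v\<in>V. c v \<in> {1..k}) \<and> adapted E f c))"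

definition adaptably_choosable :: "'a set \<Rightarrow> 'a set set \<Rightarrow> nat \<Rightarrow> bool" where
  "adaptably_choosable V E k \<longleftrightarrow>
     (\<forall>f L. list_assignment V k L \<longrightarrow> (\<exists>c. (\<forall>v\<in>V. c v \<in> L v) \<and> adapted E f c))"

definition separation_choosable :: "'a set \<Rightarrow> 'a set set \<Rightarrow> nat \<Rightarrow> bool" where
  "separation_choosable V E k \<longleftrightarrow>
     (\<forall>L. list_assignment V k L \<and> (\<forall>x y. {x, y} \<in> E \<longrightarrow> card (L x \<inter> L y) \<le> 1) \<longrightarrow>
        (\<exists>\<phi>. (\<forall>v\<in>V. \<phi> v \<in> L v) \<and> proper_coloring E \<phi>))"

definition single_conflict_colorable :: "'a set \<Rightarrow> 'a set set \<Rightarrow> nat \<Rightarrow> bool" where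
  "single_conflict_colorable V E k \<longleftrightarrow>
     (\<forall>cv. local_partition V E k cv \<longrightarrow> conflict_colorable V E k cv)"

section \<open>Monotonicity in the list size\<close>

lemma list_assignment_sublists:
  assumes "list_assignment V k L" "j \<le> k"
  obtains L' where "list_assignment V j L'" "\<And>v. v \<in> V \<Longrightarrow> L' v \<subseteq> L v"
proof -
  have "\<exists>S. S \<subseteq> L v \<and> card S = j \<and> finite S" if "v \<in> V" for v
    using assms that obtain_subset_with_card_n[of j "L v"] unfolding list_assignment_def by metis
  then obtain L' where "\<forall>v\<in>V. L' v \<subseteq> L v \<and> card (L' v) = j \<and> finite (L' v)"
    by metis
  then show thesis by (intro that[of L']) (auto simp: list_assignment_def)
qed

text \<open>A coloring from sublists is a coloring from the lists. Hence refuting one list size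
  refutes all smaller ones, as a lower bound for the minimum requires.\<close>

lemma adaptably_choosable_mono:
  assumes "adaptably_choosable V E j" "j \<le> k"
  shows "adaptably_choosable V E k"
  unfolding adaptably_choosable_def
proof (intro allI impI)
  fix f :: "'a set \<Rightarrow> nat" and L assume "list_assignment V k L"
  then obtain L' where L': "list_assignment V j L'" "\<And>v. v \<in> V \<Longrightarrow> L' v \<subseteq> L v"
    using assms(2) list_assignment_sublists by blast
  obtain c where "\<forall>v\<in>V. c v \<in> L' v" "adapted E f c"
    using assms(1) L'(1) unfolding adaptably_choosable_def by blast
  then show "\<exists>c. (\<forall>v\<in>V. c v \<in> L v) \<and> adapted E f c" using L'(2) by blast
qed

lemma separation_choosable_mono:
  assumes "separation_choosable V E j" "j \<le> k" "simple_graph V E"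
  shows "separation_choosable V E k"
  unfolding separation_choosable_def
proof (intro allI impI)
  fix L :: "'a \<Rightarrow> nat set"
  assume L: "list_assignment V k L \<and> (\<forall>x y. {x, y} \<in> E \<longrightarrow> card (L x \<inter> L y) \<le> 1)"
  then obtain L' where L': "list_assignment V j L'" "\<And>v. v \<in> V \<Longrightarrow> L' v \<subseteq> L v"
    using assms(2) list_assignment_sublists by blast
  have "card (L' x \<inter> L' y) \<le> 1" if "{x, y} \<in> E" for x y
  proof -
    \<comment> \<open>Only on \<open>V\<close> are the lists known to be finite and to contain the
      sublists.\<close>
    have xy: "x \<in> V" "y \<in> V" using that assms(3) by (auto simp: simple_graph_def)
    then have "card (L' x \<inter> L' y) \<le> card (L x \<inter> L y)"
      using L L'(2) by (intro card_mono) (auto simp: list_assignment_def)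
    with L that show ?thesis by fastforce
  qed
  then obtain \<phi> where "\<forall>v\<in>V. \<phi> v \<in> L' v" "proper_coloring E \<phi>"
    using assms(1) L'(1) unfolding separation_choosable_def by blast
  then show "\<exists>\<phi>. (\<forall>v\<in>V. \<phi> v \<in> L v) \<and> proper_coloring E \<phi>" using L'(2) by blast
qed

text \<open>Number the colors of each list from 1 to \<open>k\<close> and let the part of
  \<open>e\<close> at \<open>v\<close> be the number of \<open>f e\<close>; two ends of color
  \<open>f e\<close> then form a conflict. This yields the upper bound for adaptable choosability
  and the lower bound for the single conflict number.\<close>

lemma adaptably_choosable_if_single_conflict_colorable:
  assumes "single_conflict_colorable V E k" "1 \<le> k" "simple_graph V E"
  shows "adaptably_choosable V E k"
  unfolding adaptably_choosable_def
proof (intro allI impI)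
  fix f :: "'a set \<Rightarrow> nat" and L assume L: "list_assignment V k L"
  have "\<forall>v\<in>V. \<exists>h. bij_betw h {1..k} (L v)"
    using L by (auto simp: list_assignment_def intro!: finite_same_card_bij)
  then obtain h where h: "\<And>v. v \<in> V \<Longrightarrow> bij_betw (h v) {1..k} (L v)"
    by metis
  \<comment> \<open>An edge whose color is missing from \<open>L v\<close> is no obstruction, so any part will do for it.\<close>
  define cv where
    "cv v e = (if f e \<in> L v then the_inv_into {1..k} (h v) (f e) else 1)" for v e
  have inj: "inj_on (h v) {1..k}" and image: "h v ` {1..k} = L v" if "v \<in> V" for v
    using h[OF that] by (simp_all add: bij_betw_def)
  have "cv v e \<in> {1..k}" if "v \<in> V" for v e
  proof (cases "f e \<in> L v")
    case True
    then have "the_inv_into {1..k} (h v) (f e) \<in> {1..k}"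
      unfolding image[OF that, symmetric] by (rule the_inv_into_into[OF inj[OF that] _ subset_refl])
    with True show ?thesis by (simp add: cv_def)
  qed (use assms(2) in \<open>simp add: cv_def\<close>)
  then have "local_partition V E k cv" unfolding local_partition_def by blast
  with assms(1) have "conflict_colorable V E k cv"
    unfolding single_conflict_colorable_def by blast
  then obtain \<phi> where \<phi>: "\<And>v. v \<in> V \<Longrightarrow> \<phi> v \<in> {1..k}"
    and conf: "\<And>x y. {x, y} \<in> E \<Longrightarrow> \<not> (\<phi> x = cv x {x, y} \<and> \<phi> y = cv y {x, y})"
    unfolding conflict_colorable_def by blast
  have in_L: "h v (\<phi> v) \<in> L v" if "v \<in> V" for v
    using \<phi>[OF that] image[OF that] by blast
  have "adapted E f (\<lambda>v. h v (\<phi> v))"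
    unfolding adapted_def
  proof (intro allI impI notI)
    fix x y assume xy: "{x, y} \<in> E" and eq: "h x (\<phi> x) = h y (\<phi> y) \<and> h y (\<phi> y) = f {x, y}"
    have part: "\<phi> v = cv v {x, y}" if "v \<in> V" "h v (\<phi> v) = f {x, y}" for v
      using in_L[OF that(1)] the_inv_into_f_f[OF inj[OF that(1)] \<phi>[OF that(1)]] that(2)
      by (simp add: cv_def)
    have V: "x \<in> V" "y \<in> V" using xy assms(3) by (auto simp: simple_graph_def)
    have "\<phi> x = cv x {x, y}" by (rule part[OF V(1)]) (use eq in simp)
    moreover have "\<phi> y = cv y {x, y}" by (rule part[OF V(2)]) (use eq in simp)
    ultimately show False using conf[OF xy] by blast
  qed
  with in_L show "\<exists>c. (\<forall>v\<in>V. c v \<in> L v) \<and> adapted E f c"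
    by (intro exI[of _ "\<lambda>v. h v (\<phi> v)"]) simp
qed

subsection \<open>The parameters of the hub graph\<close>

lemma adaptable_hub: "adaptable (hub_verts n) (hub_edges n) 3"
proof -
  \<comment> \<open>A proper 3-coloring is adapted to every edge coloring.\<close>
  define c :: "nat \<Rightarrow> nat" where "c v = (if v \<le> 1 then 1 else if even v then 2 else 3)" for v
  have "c x \<noteq> c y" if "{x, y} \<in> hub_edges n" for x y
    using that by (rule hub_edge_ends) (auto simp: c_def)
  moreover have "c v \<in> {1..3}" for v by (simp add: c_def)
  ultimately show ?thesis unfolding adaptable_def adapted_def by blast
qed

text \<open>Fix any hub colors \<open>a\<close> and \<open>b\<close>; the pairs can then be colored
  independently. A pair fails only if removing \<open>a\<close> and \<open>b\<close> leaves both
  ends the same single color \<open>x\<close>, which makes both lists \<open>{a, b, x}\<close>,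
  against separation.\<close>

lemma separation_choosable_hub: "separation_choosable (hub_verts n) (hub_edges n) 3"
  unfolding separation_choosable_def
proof (intro allI impI)
  fix L :: "nat \<Rightarrow> nat set"
  assume L: "list_assignment (hub_verts n) 3 L \<and>
     (\<forall>x y. {x, y} \<in> hub_edges n \<longrightarrow> card (L x \<inter> L y) \<le> 1)"
  have fin: "finite (L v)" and card3: "card (L v) = 3" if "v < 2 * n + 2" for v
    using L that by (auto simp: list_assignment_def hub_verts_def)
  have "L 0 \<noteq> {}" "L 1 \<noteq> {}" using card3[of 0] card3[of 1] by auto
  then obtain a b where a: "a \<in> L 0" and b: "b \<in> L 1" by blast
  have "\<exists>p q. p \<in> L (2 * i + 2) \<and> q \<in> L (2 * i + 3) \<and> p \<notin> {a, b} \<and> q \<notin> {a, b} \<and> p \<noteq> q"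
    if i: "i < n" for i
  proof -
    let ?P = "L (2 * i + 2)" and ?Q = "L (2 * i + 3)"
    have P: "finite ?P" "card ?P = 3" and Q: "finite ?Q" "card ?Q = 3"
      using fin card3 i by auto
    have sep: "card (?P \<inter> ?Q) \<le> 1" using L hub_edges_intros(3)[OF i] by blast
    have ab: "card {a, b} \<le> 2" by (simp add: card_insert_if)
    have pos: "?P - {a, b} \<noteq> {}" "?Q - {a, b} \<noteq> {}"
      using P Q ab card_mono[of "{a, b}" ?P] card_mono[of "{a, b}" ?Q] by auto
    show ?thesis
    proof (rule ccontr)
      assume no: "\<not> ?thesis"
      obtain x where x: "x \<in> ?P - {a, b}" using pos by blast
      \<comment> \<open>No two distinct choices exist, so every color left at the second end is
        \<open>x\<close>; the same argument then applies to the first end.\<close>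
      with no pos have "?Q - {a, b} = {x}" by blast
      moreover from this no pos have "?P - {a, b} = {x}" by blast
      ultimately have "?P \<subseteq> {a, b, x}" "?Q \<subseteq> {a, b, x}" by auto
      moreover have "card {a, b, x} \<le> 3" by (simp add: card_insert_if)
      ultimately have "?P = {a, b, x}" "?Q = {a, b, x}"
        using P Q by (simp_all add: card_seteq)
      with P sep show False by simp
    qed
  qed
  then obtain p q where pq: "\<And>i. i < n \<Longrightarrow> p i \<in> L (2 * i + 2) \<and> q i \<in> L (2 * i + 3) \<and>
      p i \<notin> {a, b} \<and> q i \<notin> {a, b} \<and> p i \<noteq> q i"
    by metis
  \<comment> \<open>\<open>(v - 2) div 2\<close> is the index of the pair containing
    \<open>v\<close>, and parity tells its ends apart.\<close>
  define \<phi> where "\<phi> v = (if v = 0 then a else if v = 1 then b else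
     if even v then p ((v - 2) div 2) else q ((v - 2) div 2))" for v
  have pair: "\<phi> (2 * i + 2) = p i" "\<phi> (2 * i + 3) = q i" for i
    by (simp_all add: \<phi>_def)
  have rim: "\<phi> w \<in> L w \<and> \<phi> w \<notin> {a, b}" if "2 \<le> w" "w < 2 * n + 2" for w
  proof -
    have "\<exists>i<n. w = 2 * i + 2 \<or> w = 2 * i + 3" using that by presburger
    then obtain i where "i < n" "w = 2 * i + 2 \<or> w = 2 * i + 3" by blast
    with pq[of i] pair[of i] show ?thesis by auto
  qed
  have "\<phi> x \<noteq> \<phi> y" if "{x, y} \<in> hub_edges n" for x y
    using that
  proof (rule hub_edge_ends)
    show "\<phi> (2 * i + 2) \<noteq> \<phi> (2 * i + 3)" if "i < n" for i
      unfolding pair using pq[OF that] by blast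
  qed (use rim in \<open>force simp: \<phi>_def\<close>)+
  moreover have "\<phi> v \<in> L v" if "v \<in> hub_verts n" for v
  proof -
    consider "v = 0" | "v = 1" | "2 \<le> v" by linarith
    then show ?thesis
      by cases (use rim[of v] that a b in \<open>auto simp: \<phi>_def hub_verts_def\<close>)
  qed
  ultimately show "\<exists>\<phi>. (\<forall>v\<in>hub_verts n. \<phi> v \<in> L v) \<and> proper_coloring (hub_edges n) \<phi>"
    unfolding proper_coloring_def by blast
qed

text \<open>Each edge is made safe at one end alone: every non-hub vertex avoids its parts on the
  two hub edges, and the even end of each pair also avoids its part on the pair edge. At most three
  of the four colors are excluded, and the hub colors are arbitrary.\<close>

lemma single_conflict_colorable_hub: "single_conflict_colorable (hub_verts n) (hub_edges n) 4"
  unfolding single_conflict_colorable_def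
proof (intro allI impI)
  fix cv :: "nat \<Rightarrow> nat set \<Rightarrow> nat"
  have avoid: "\<exists>t\<in>{1..4}. t \<notin> {x, y, z}" for x y z :: nat
  proof -
    have "\<not> {1..4} \<subseteq> {x, y, z}"
      using card_mono[of "{x, y, z}" "{1..4}"] by (auto simp: card_insert_if split: if_splits)
    then show ?thesis by blast
  qed
  have "\<forall>w. \<exists>t. t \<in> {1..4} \<and> t \<notin> {cv w {0, w}, cv w {1, w}, cv w {w, Suc w}}"
    using avoid by blast
  then obtain p where p: "\<And>w. p w \<in> {1..4::nat}"
    "\<And>w. p w \<notin> {cv w {0, w}, cv w {1, w}, cv w {w, Suc w}}"
    by metis
  have "\<forall>w. \<exists>t. t \<in> {1..4} \<and> t \<notin> {cv w {0, w}, cv w {1, w}}"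
    using avoid by blast
  then obtain q where q: "\<And>w. q w \<in> {1..4::nat}" "\<And>w. q w \<notin> {cv w {0, w}, cv w {1, w}}"
    by metis
  define \<phi> where "\<phi> v = (if even v \<and> 2 \<le> v then p v else q v)" for v
  have "\<not> (\<phi> x = cv x {x, y} \<and> \<phi> y = cv y {x, y})" if "{x, y} \<in> hub_edges n" for x y
    using that
  proof (rule hub_edge_ends)
    show "\<not> (\<phi> y = cv y {y, x} \<and> \<phi> x = cv x {y, x})"
      if "\<not> (\<phi> x = cv x {x, y} \<and> \<phi> y = cv y {x, y})" for x y
      using that by (auto simp: insert_commute)
    show "\<not> (\<phi> (2 * i + 2) = cv (2 * i + 2) {2 * i + 2, 2 * i + 3} \<and>
       \<phi> (2 * i + 3) = cv (2 * i + 3) {2 * i + 2, 2 * i + 3})" for i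
      using p(2)[of "2 * i + 2"] by (simp add: \<phi>_def numeral_3_eq_3)
  qed (use p(2) q(2) in \<open>auto simp: \<phi>_def\<close>)
  moreover have "\<phi> v \<in> {1..4}" for v
    using p(1)[of v] q(1)[of v] by (auto simp: \<phi>_def)
  ultimately show "conflict_colorable (hub_verts n) (hub_edges n) 4 cv"
    unfolding conflict_colorable_def by blast
qed

section \<open>Lower bounds\<close>

lemma not_adaptable_1_hub:
  assumes "1 \<le> n"
  shows "\<not> adaptable (hub_verts n) (hub_edges n) 1"
proof
  assume "adaptable (hub_verts n) (hub_edges n) 1"
  then obtain c :: "nat \<Rightarrow> nat" where "\<forall>v\<in>hub_verts n. c v \<in> {1..1}"
    and "adapted (hub_edges n) (\<lambda>_. 1) c"
    unfolding adaptable_def by (elim allE[of _ "\<lambda>_. 1"]) auto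
  moreover have "{0, 2} \<in> hub_edges n" using assms by (intro hub_edges_intros) auto
  ultimately show False
    using assms unfolding adapted_def hub_verts_def by fastforce
qed

text \<open>The largest vertex of an edge is never a hub, so \<open>(Max e - 2) div 2\<close> is the
  index of its pair for all three kinds of edges.\<close>

definition hub_edge_coloring :: "(nat \<Rightarrow> 'c) \<Rightarrow> (nat \<Rightarrow> 'c) \<Rightarrow> (nat \<Rightarrow> 'c) \<Rightarrow> nat set \<Rightarrow> 'c" where
  "hub_edge_coloring a b d e =
     (let i = (Max e - 2) div 2 in if 0 \<in> e then a i else if 1 \<in> e then b i else d i)"

lemma hub_edge_coloring_adapted:
  assumes "adapted (hub_edges n) (hub_edge_coloring a b d) c" "i < n"
    and "w = 2 * i + 2 \<or> w = 2 * i + 3"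
  shows "c 0 = a i \<Longrightarrow> c w \<noteq> a i" "c 1 = b i \<Longrightarrow> c w \<noteq> b i"
    "c (2 * i + 2) = d i \<Longrightarrow> c (2 * i + 3) \<noteq> d i"
proof -
  have edges: "{0, w} \<in> hub_edges n" "{1, w} \<in> hub_edges n"
    "{2 * i + 2, 2 * i + 3} \<in> hub_edges n"
    by (rule hub_edges_intros; use assms(2,3) in auto)+
  have colors: "hub_edge_coloring a b d {0, w} = a i" "hub_edge_coloring a b d {1, w} = b i"
    "hub_edge_coloring a b d {2 * i + 2, 2 * i + 3} = d i"
    using assms(3) by (auto simp: hub_edge_coloring_def Let_def)
  show "c 0 = a i \<Longrightarrow> c w \<noteq> a i" "c 1 = b i \<Longrightarrow> c w \<noteq> b i"
    "c (2 * i + 2) = d i \<Longrightarrow> c (2 * i + 3) \<noteq> d i"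
    using edges colors assms(1) unfolding adapted_def by metis+
qed

text \<open>The color of hub \<open>0\<close> is \<open>a i\<close> for one of the first two pairs.
  This forces \<open>3 - a i\<close> on both ends of that pair, which is the color of the edge
  between them.\<close>

lemma not_adaptable_2_hub:
  assumes "2 \<le> n"
  shows "\<not> adaptable (hub_verts n) (hub_edges n) 2"
proof
  define a where "a i = 1 + i mod 2" for i :: nat
  let ?f = "hub_edge_coloring a a (\<lambda>i. 3 - a i)"
  assume "adaptable (hub_verts n) (hub_edges n) 2"
  moreover have "?f e \<in> {1..2}" for e
    by (auto simp: hub_edge_coloring_def Let_def a_def)
  ultimately obtain c where c: "\<And>v. v \<in> hub_verts n \<Longrightarrow> c v \<in> {1..2}"
    and ad: "adapted (hub_edges n) ?f c"
    unfolding adaptable_def by meson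
  have c0: "c 0 \<in> {1..2}" using c by (simp add: hub_verts_def)
  then have "c 0 = 1 \<or> c 0 = 2" by auto
  then have "\<exists>i<2. c 0 = a i"
    by (intro exI[of _ "c 0 - 1"]) (auto simp: a_def)
  then obtain i where i: "i < 2" "c 0 = a i" by blast
  then have i_n: "i < n" using assms by simp
  have "c w = 3 - a i" if w: "w = 2 * i + 2 \<or> w = 2 * i + 3" for w
  proof -
    have "w \<in> hub_verts n" using w i_n by (auto simp: hub_verts_def)
    then have "c w \<in> {1..2}" by (rule c)
    moreover have "c w \<noteq> a i" using hub_edge_coloring_adapted(1)[OF ad i_n w i(2)] .
    ultimately show ?thesis using c0 i(2) by auto
  qed
  then show False using hub_edge_coloring_adapted(3)[OF ad i_n] by blast
qed

text \<open>One vertex per choice of hub colors is enough: for \<open>i < 4\<close>, the even end of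
  the \<open>i\<close>-th pair has the \<open>i\<close>-th choice as its list. The odd ends get
  \<open>{4, 5}\<close>, disjoint from the lists of all their neighbors, so the lists stay
  separated.\<close>

lemma not_separation_choosable_2_hub:
  assumes "4 \<le> n"
  shows "\<not> separation_choosable (hub_verts n) (hub_edges n) 2"
proof
  define L :: "nat \<Rightarrow> nat set" where "L v = (if v = 0 then {0, 1} else if v = 1 then {2, 3} else
     if even v then {(v - 2) div 2 mod 2, 2 + (v - 2) div 2 div 2 mod 2} else {4, 5})" for v
  assume "separation_choosable (hub_verts n) (hub_edges n) 2"
  moreover have "list_assignment (hub_verts n) 2 L"
    by (auto simp: list_assignment_def L_def card_insert_if)
  moreover have "card (L x \<inter> L y) \<le> 1" if "{x, y} \<in> hub_edges n" for x y
    using that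
  proof (rule hub_edge_ends)
    show "card (L y \<inter> L x) \<le> 1" if "card (L x \<inter> L y) \<le> 1" for x y
      using that by (simp add: Int_commute)
    show "card (L 0 \<inter> L w) \<le> 1" if "2 \<le> w" for w
      using that by (auto simp: L_def Int_insert_right card_insert_if)
    show "card (L 1 \<inter> L w) \<le> 1" if "2 \<le> w" for w
      using that by (auto simp: L_def Int_insert_right card_insert_if)
    show "card (L (2 * i + 2) \<inter> L (2 * i + 3)) \<le> 1" for i
      by (auto simp: L_def Int_insert_right card_insert_if)
  qed
  ultimately obtain \<phi> where \<phi>: "\<And>v. v \<in> hub_verts n \<Longrightarrow> \<phi> v \<in> L v"
    and proper: "\<And>x y. {x, y} \<in> hub_edges n \<Longrightarrow> \<phi> x \<noteq> \<phi> y"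
    unfolding separation_choosable_def proper_coloring_def by metis
  have "\<phi> 0 \<in> L 0" "\<phi> 1 \<in> L 1" using \<phi> by (simp_all add: hub_verts_def)
  \<comment> \<open>The binary digits of the witness are \<open>\<phi> 0\<close> and
    \<open>\<phi> 1 - 2\<close>.\<close>
  then have "\<exists>i<4. \<phi> 0 = i mod 2 \<and> \<phi> 1 = 2 + i div 2 mod 2"
    by (intro exI[of _ "\<phi> 0 + 2 * (\<phi> 1 - 2)"]) (auto simp: L_def)
  then obtain i where i: "i < 4" "\<phi> 0 = i mod 2" "\<phi> 1 = 2 + i div 2 mod 2" by blast
  have "\<phi> (2 * i + 2) \<in> L (2 * i + 2)"
    using i assms by (intro \<phi>) (simp add: hub_verts_def)
  then have "\<phi> (2 * i + 2) \<in> {\<phi> 0, \<phi> 1}" using i by (simp add: L_def)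
  moreover have "{0, 2 * i + 2} \<in> hub_edges n" "{1, 2 * i + 2} \<in> hub_edges n"
    by (rule hub_edges_intros; use i assms in simp)+
  ultimately show False using proper by fastforce
qed

lemma not_adaptably_choosable_3_hub:
  assumes "9 \<le> n"
  shows "\<not> adaptably_choosable (hub_verts n) (hub_edges n) 3"
proof
  \<comment> \<open>The two lowest ternary digits of \<open>i\<close> select the hub colors, so the
    indices below 9 cover all nine choices; \<open>mod 3\<close> in \<open>b\<close> keeps its
    values below 6 for larger \<open>i\<close>, so that all lists have three colors.\<close>
  define a b where "a i = i mod 3" and "b i = 3 + i div 3 mod 3" for i :: nat
  define L :: "nat \<Rightarrow> nat set" where "L v = (if v = 0 then {0, 1, 2} else
     if v = 1 then {3, 4, 5} else {a ((v - 2) div 2), b ((v - 2) div 2), 6})" for v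
  let ?f = "hub_edge_coloring a b (\<lambda>_. 6)"
  assume "adaptably_choosable (hub_verts n) (hub_edges n) 3"
  moreover have "list_assignment (hub_verts n) 3 L"
  proof -
    have "a i \<noteq> b i" "a i \<noteq> 6" "b i \<noteq> 6" for i
    proof -
      have "a i < 3" "3 \<le> b i" "b i < 6" by (simp_all add: a_def b_def)
      then show "a i \<noteq> b i" "a i \<noteq> 6" "b i \<noteq> 6" by linarith+
    qed
    then show ?thesis by (auto simp: list_assignment_def L_def card_insert_if)
  qed
  ultimately obtain c where c: "\<And>v. v \<in> hub_verts n \<Longrightarrow> c v \<in> L v"
    and ad: "adapted (hub_edges n) ?f c"
    unfolding adaptably_choosable_def by metis
  have "c 0 \<in> L 0" "c 1 \<in> L 1" using c by (simp_all add: hub_verts_def)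
  then have "\<exists>i<9. c 0 = a i \<and> c 1 = b i"
    by (intro exI[of _ "c 0 + 3 * (c 1 - 3)"]) (auto simp: L_def a_def b_def)
  then obtain i where i: "i < 9" "c 0 = a i" "c 1 = b i" by blast
  then have i_n: "i < n" using assms by simp
  have w: "c (2 * i + 2) \<in> L (2 * i + 2)" "c (2 * i + 3) \<in> L (2 * i + 3)"
    by (rule c; use i_n in \<open>simp add: hub_verts_def\<close>)+
  have "L (2 * i + 2) = {a i, b i, 6}" "L (2 * i + 3) = {a i, b i, 6}"
    by (simp_all add: L_def)
  \<comment> \<open>Both ends of this pair are left with color 6, which is also the color of the
    edge between them.\<close>
  with i w hub_edge_coloring_adapted[OF ad i_n, of "2 * i + 2"]
    hub_edge_coloring_adapted[OF ad i_n, of "2 * i + 3"]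
  show False by auto
qed

theorem theorem4p7:
  shows "\<exists>(V :: nat set) E. simple_graph V E \<and> planar V E \<and>
    3 = adaptable_chromatic_number V E \<and>
    adaptable_chromatic_number V E = separation_choosability V E \<and>
    separation_choosability V E < adaptable_choosability V E \<and>
    adaptable_choosability V E = single_conflict_chromatic_number V E \<and>
    single_conflict_chromatic_number V E = 4"
proof -
  let ?V = "hub_verts 9" and ?E = "hub_edges 9"
  note graph = simple_graph_hub[of 9]
  have least: "(LEAST k. 1 \<le> k \<and> P k) = Suc m"
    if "P (Suc m)" "\<And>k. 1 \<le> k \<Longrightarrow> P k \<Longrightarrow> \<not> k \<le> m" for P m
    using that by (intro Least_equality) (auto simp: not_le Suc_le_eq)
  have not_choosable: "\<not> k \<le> 3" if "adaptably_choosable ?V ?E k" for k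
    using that adaptably_choosable_mono not_adaptably_choosable_3_hub[of 9] by blast
  have "adaptable_chromatic_number ?V ?E = Suc 2"
    unfolding adaptable_chromatic_number_def adaptable_def[symmetric]
  proof (rule least)
    show "adaptable ?V ?E (Suc 2)" using adaptable_hub[of 9] by simp
    show "\<not> k \<le> 2" if "1 \<le> k" "adaptable ?V ?E k" for k
    proof
      assume "k \<le> 2"
      \<comment> \<open>Positivity leaves only 1 and 2, each refuted by its own edge
        coloring.\<close>
      with that(1) have "k = 1 \<or> k = 2" by auto
      with that(2) not_adaptable_1_hub[of 9] not_adaptable_2_hub[of 9] show False by auto
    qed
  qed
  moreover have "separation_choosability ?V ?E = Suc 2"
    unfolding separation_choosability_def separation_choosable_def[symmetric]
    using separation_choosable_mono[OF _ _ graph] separation_choosable_hub[of 9]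
      not_separation_choosable_2_hub[of 9]
    by (intro least) auto
  moreover have "adaptable_choosability ?V ?E = Suc 3"
    unfolding adaptable_choosability_def adaptably_choosable_def[symmetric]
    using not_choosable single_conflict_colorable_hub[of 9]
      adaptably_choosable_if_single_conflict_colorable[OF _ _ graph]
    by (intro least) auto
  \<comment> \<open>The lower bound is inherited: a \<open>k\<close> that works here also works for
    adaptable choosability.\<close>
  moreover have "single_conflict_chromatic_number ?V ?E = Suc 3"
    unfolding single_conflict_chromatic_number_def single_conflict_colorable_def[symmetric]
    using not_choosable single_conflict_colorable_hub[of 9]
      adaptably_choosable_if_single_conflict_colorable[OF _ _ graph]
    by (intro least) auto
  ultimately show ?thesis
    using graph planar_hub[of 9] by (intro exI[of _ ?V] exI[of _ ?E]) simp
qed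

end
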